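(* For a multiplicatively cancellative semiring $S$ with semifield of fractions $F(S)$, the following statements are equivalent: (1) $S$ is a valuation semiring; (2) For any nonzero element $x\in F(S)$, either $x\in S$ or $x^{-1}\in S$; (3) For any ideals $I,J$ of $S$, either $I\subseteq J$ or $J\subseteq I$; (4) For any elements $x,y\in S$, either $(x)\subseteq (y)$ or $(y)\subseteq (x)$.
   Context: All semirings are commutative, with a zero $0$ (absorbing for multiplication) and an identity $1\neq 0$. A semiring $S$ is multiplicatively cancellative (MC) if $ab=ac$ and $a\neq 0$ imply $b=c$ for all $a,b,c\in S$. A semifield is a semiring in which every nonzero element is multiplicatively invertible. For an MC semiring $S$, $F(S)$ denotes its semifield of fractions, whose elements are the fractions $a/b$ with $a\in S$, $b\in S\setminus\{0\}$; $S$ is regarded as a subsemiring of $F(S)$ via $a\mapsto a/1$. An ideal of $S$ is a nonempty subset closed under addition and under multiplication by elements of $S$; $(a)=\{sa: s\in S\}$ is the principal ideal generated by $a$. A tomonoid $(M,+,0,\leq)$ is a commutative monoid $(M,+,0)$ with a total order $\leq$ such that $x\leq y$ implies $x+z\leq y+z$ for all $z\in M$. For a tomonoid $M$ with no greatest element, or $M=\{0\}$, let $M_\infty = M\cup\{+\infty\}$ be the tomonoid obtained by adjoining a new element $+\infty$ with $m<+\infty$ for all $m\in M$ and $m+(+\infty)=(+\infty)+m=+\infty$ for all $m\in M_\infty$. For such $M$, an $M$-valuation on a semiring $K$ is a map $v:K\to M_\infty$ such that $v(xy)=v(x)+v(y)$ and $v(x+y)\geq\min\{v(x),v(y)\}$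 for all $x,y\in K$, $v(1)=0$ and $v(0)=+\infty$. A semiring $S$ is a valuation semiring if there exist a semifield $K$ containing $S$ as a subsemiring and a surjective $M$-valuation $v$ on $K$ (for some such $M$) with $S=K_v=\{s\in K: v(s)\geq 0\}$. *)

theory Defs
  imports "HOL-Algebra.Algebra"
begin

section \<open>Commutative semirings\<close>

locale commutative_semiring = semiring S + comm_monoid S for S (structure) +
  assumes one_not_zero: "\<one> \<noteq> \<zero>"

locale mc_semiring = commutative_semiring S for S (structure) +
  assumes mult_cancel: "\<lbrakk>a \<in> carrier S; b \<in> carrier S; c \<in> carrier S; a \<otimes> b = a \<otimes> c; a \<noteq> \<zero>\<rbrakk> \<Longrightarrow> b = c"

locale semifield = commutative_semiring K for K (structure) +
  assumes nonzero_Units: "\<lbrakk>x \<in> carrier K; x \<noteq> \<zero>\<rbrakk> \<Longrightarrow> x \<in> Units K"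

text \<open>Unlike for rings, a map in \<^const>\<open>ring_hom\<close> between semirings need not preserve zero, so this
  has to be required.  ``\<open>K\<close> contains \<open>S\<close> as a subsemiring'' is expressed by an embedding of
  \<open>S\<close> into \<open>K\<close>.\<close>

definition semiring_embedding ::
  "('a, 'x) ring_scheme \<Rightarrow> ('b, 'y) ring_scheme \<Rightarrow> ('a \<Rightarrow> 'b) set" where
  "semiring_embedding S K =
     {h \<in> ring_hom S K. h \<zero>\<^bsub>S\<^esub> = \<zero>\<^bsub>K\<^esub> \<and> inj_on h (carrier S)}"

definition semiring_ideal :: "'a set \<Rightarrow> ('a, 'x) ring_scheme \<Rightarrow> bool" where
  "semiring_ideal I S \<longleftrightarrow> I \<subseteq> carrier S \<and> I \<noteq> {} \<and>
     (\<forall>x\<in>I. \<forall>y\<in>I. x \<oplus>\<^bsub>S\<^esub> y \<in> I) \<and> (\<forall>s\<in>carrier S. \<forall>x\<in>I. s \<otimes>\<^bsub>S\<^esub> x \<in> I)"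


section \<open>The semifield of fractions\<close>

text \<open>The relation \<open>(a, b) \<sim> (c, d) \<longleftrightarrow> a d = c b\<close>; it is transitive if \<open>S\<close> is
  multiplicatively cancellative.\<close>

definition fract_rel :: "('a, 'x) ring_scheme \<Rightarrow> ('a \<times> 'a) rel" where
  "fract_rel S = {((a, b), (c, d)). a \<in> carrier S \<and> c \<in> carrier S \<and>
     b \<in> carrier S - {\<zero>\<^bsub>S\<^esub>} \<and> d \<in> carrier S - {\<zero>\<^bsub>S\<^esub>} \<and> a \<otimes>\<^bsub>S\<^esub> d = c \<otimes>\<^bsub>S\<^esub> b}"

definition fract :: "('a, 'x) ring_scheme \<Rightarrow> 'a \<Rightarrow> 'a \<Rightarrow> ('a \<times> 'a) set" where
  "fract S a b = fract_rel S `` {(a, b)}"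

text \<open>The operations are \<open>a/b \<sdot> c/d = ac/bd\<close> and \<open>a/b + c/d = (ad + cb)/bd\<close>.  The unions run over
  all representatives and are unions of equal sets when \<open>S\<close> is multiplicatively cancellative.\<close>

definition fract_semifield :: "('a, 'x) ring_scheme \<Rightarrow> ('a \<times> 'a) set ring" where
  "fract_semifield S =
     \<lparr>carrier = (carrier S \<times> (carrier S - {\<zero>\<^bsub>S\<^esub>})) // fract_rel S,
      monoid.mult = (\<lambda>P Q. \<Union>(a, b)\<in>P. \<Union>(c, d)\<in>Q. fract S (a \<otimes>\<^bsub>S\<^esub> c) (b \<otimes>\<^bsub>S\<^esub> d)),
      one = fract S \<one>\<^bsub>S\<^esub> \<one>\<^bsub>S\<^esub>,
      ring.zero = fract S \<zero>\<^bsub>S\<^esub> \<one>\<^bsub>S\<^esub>,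
      add = (\<lambda>P Q. \<Union>(a, b)\<in>P. \<Union>(c, d)\<in>Q.
               fract S (a \<otimes>\<^bsub>S\<^esub> d \<oplus>\<^bsub>S\<^esub> c \<otimes>\<^bsub>S\<^esub> b) (b \<otimes>\<^bsub>S\<^esub> d))\<rparr>"

definition fract_embed :: "('a, 'x) ring_scheme \<Rightarrow> 'a \<Rightarrow> ('a \<times> 'a) set" where
  "fract_embed S a = fract S a \<one>\<^bsub>S\<^esub>"


section \<open>Totally ordered monoids\<close>

text \<open>As everywhere in HOL-Algebra, the operation of a monoid is written \<open>\<otimes>\<close> and its neutral
  element \<open>\<one>\<close>; they stand for the addition and the \<open>0\<close> of a tomonoid.
  Here \<open>(x, y) \<in> leq M\<close> means \<open>x \<le> y\<close>.\<close>

record 'm tomonoid = "'m monoid" +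
  leq :: "'m rel"

locale tomonoid = comm_monoid M for M :: "('m, 'z) tomonoid_scheme" (structure) +
  assumes leq_linear: "linear_order_on (carrier M) (leq M)"
    and leq_mono: "\<lbrakk>(x, y) \<in> leq M; z \<in> carrier M\<rbrakk> \<Longrightarrow> (x \<otimes> z, y \<otimes> z) \<in> leq M"

text \<open>\<open>M\<^sub>\<infinity>\<close>, with \<^const>\<open>None\<close> in the role of \<open>+\<infinity>\<close>.\<close>

definition adjoin_infinity :: "'m tomonoid \<Rightarrow> 'm option tomonoid" where
  "adjoin_infinity M =
     \<lparr>carrier = insert None (Some ` carrier M),
      monoid.mult = (\<lambda>x y. case (x, y) of (Some a, Some b) \<Rightarrow> Some (a \<otimes>\<^bsub>M\<^esub> b) | _ \<Rightarrow> None),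
      one = Some \<one>\<^bsub>M\<^esub>,
      leq = {(Some a, Some b) | a b. (a, b) \<in> leq M} \<union> insert None (Some ` carrier M) \<times> {None}\<rparr>"

definition tomonoid_min :: "'m tomonoid \<Rightarrow> 'm \<Rightarrow> 'm \<Rightarrow> 'm" where
  "tomonoid_min M x y = (if (x, y) \<in> leq M then x else y)"


section \<open>Valuations\<close>

locale valuation = commutative_semiring K + tomonoid M
  for M :: "'m tomonoid" and K :: "('k, 'x) ring_scheme" and v :: "'k \<Rightarrow> 'm option" +
  assumes no_greatest_or_trivial:
      "(\<nexists>g. g \<in> carrier M \<and> (\<forall>x\<in>carrier M. (x, g) \<in> leq M)) \<or> carrier M = {\<one>\<^bsub>M\<^esub>}"
    and val_closed: "v \<in> carrier K \<rightarrow> carrier (adjoin_infinity M)"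
    and val_mult: "\<lbrakk>x \<in> carrier K; y \<in> carrier K\<rbrakk> \<Longrightarrow> v (x \<otimes>\<^bsub>K\<^esub> y) = v x \<otimes>\<^bsub>adjoin_infinity M\<^esub> v y"
    and val_add: "\<lbrakk>x \<in> carrier K; y \<in> carrier K\<rbrakk> \<Longrightarrow>
      (tomonoid_min (adjoin_infinity M) (v x) (v y), v (x \<oplus>\<^bsub>K\<^esub> y)) \<in> leq (adjoin_infinity M)"
    and val_one: "v \<one>\<^bsub>K\<^esub> = \<one>\<^bsub>adjoin_infinity M\<^esub>"
    and val_zero: "v \<zero>\<^bsub>K\<^esub> = None"

definition nonneg_part ::
  "'m tomonoid \<Rightarrow> ('k, 'x) ring_scheme \<Rightarrow> ('k \<Rightarrow> 'm option) \<Rightarrow> 'k set" where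
  "nonneg_part M K v = {s \<in> carrier K. (\<one>\<^bsub>adjoin_infinity M\<^esub>, v s) \<in> leq (adjoin_infinity M)}"

text \<open>A quantifier over semifields \<open>K\<close> and tomonoids \<open>M\<close> can only range over structures with
  carriers in given types, which are therefore parameters here.\<close>

definition valuation_semiring_in ::
  "'k itself \<Rightarrow> 'm itself \<Rightarrow> ('a, 'x) ring_scheme \<Rightarrow> bool" where
  "valuation_semiring_in _ _ S \<longleftrightarrow> commutative_semiring S \<and>
     (\<exists>(K :: 'k ring) (M :: 'm tomonoid) v h.
        semifield K \<and> valuation M K v \<and> v ` carrier K = carrier (adjoin_infinity M) \<and>
        h \<in> semiring_embedding S K \<and> h ` carrier S = nonneg_part M K v)"

text \<open>The types chosen here are large enough to hold every \<open>K\<close> and \<open>M\<close> that can occur, up to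
  isomorphism: if \<open>S = K\<^sub>v\<close>, then \<open>x \<in> S\<close> or \<open>x\<inverse> \<in> S\<close> for every nonzero \<open>x \<in> K\<close>, so \<open>K\<close> consists
  of fractions of elements of \<open>S\<close>, and \<open>M\<^sub>\<infinity>\<close> is the image of \<open>K\<close> under \<open>v\<close>.\<close>

definition valuation_semiring :: "('a, 'x) ring_scheme \<Rightarrow> bool" where
  "valuation_semiring S \<longleftrightarrow>
     valuation_semiring_in TYPE(('a \<times> 'a) set) TYPE(('a \<times> 'a) set set) S"

end

theory Submission
  imports Defs
begin

text \<open>
  All the conditions express that divisibility in \<open>S\<close> is total.  In the semifield of fractions, \<open>a/b\<close>
  lies in \<open>S\<close> iff \<open>b\<close> divides \<open>a\<close>, and \<open>(a/b)\<inverse> = b/a\<close>; so the condition on fractions says that of any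
  two nonzero elements of \<open>S\<close> one divides the other, which is comparability of principal ideals
  (\<open>fract_or_inv_iff_cgenideals_chain\<close>).  Comparability passes from principal ideals to all ideals:
  if \<open>x \<in> I\<close> is outside \<open>J\<close>, then no \<open>y \<in> J\<close> divides \<open>x\<close>, so \<open>x\<close> divides every \<open>y \<in> J\<close>
  (\<open>ideals_chain_iff_cgenideals_chain\<close>).

  Let \<open>S\<close> be the set of elements of nonnegative value for a valuation \<open>v\<close> on \<open>K\<close>, and let \<open>v x \<le> v y\<close>
  with \<open>x\<close> and \<open>y\<close> nonzero.  Then \<open>y x\<inverse>\<close> has nonnegative value, so \<open>x\<close> divides \<open>y\<close> in \<open>S\<close>.  As the order of
  values is total, principal ideals are comparable (\<open>valuation_semiring_in_cgenideals_chain\<close>).  This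
  argument works for \<open>K\<close> and \<open>M\<close> over any types, which is why the choice of types in the definition of
  a valuation semiring does not matter.

  Conversely, the condition on fractions yields a valuation on the semifield of fractions \<open>K\<close>.  The
  traditional value group, the nonzero elements of \<open>K\<close> modulo the units of \<open>S\<close>, is represented by the
  principal fractional ideals \<open>S x\<close> under set multiplication and reverse inclusion, with \<open>v x = S x\<close>: a
  larger value is a smaller ideal.  Antisymmetry and monotonicity of the order come for free, and the
  condition on fractions makes it total.  The locale \<open>total_subsemiring\<close> carries this out for any
  semifield and any subsemiring that contains each nonzero element or its inverse.
\<close>

section \<open>Chains of ideals\<close>

context commutative_semiring
begin

lemma cgenideal_subset_iff:
  assumes "x \<in> carrier S" "y \<in> carrier S"
  shows "PIdl x \<subseteq> PIdl y \<longleftrightarrow> (\<exists>s\<in>carrier S. x = s \<otimes> y)"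
proof
  assume "PIdl x \<subseteq> PIdl y"
  moreover have "\<one> \<otimes> x \<in> PIdl x"
    unfolding cgenideal_def by blast
  ultimately show "\<exists>s\<in>carrier S. x = s \<otimes> y"
    using assms by (auto simp: cgenideal_def)
next
  assume "\<exists>s\<in>carrier S. x = s \<otimes> y"
  then obtain s where "s \<in> carrier S" "x = s \<otimes> y" by blast
  then have "t \<otimes> x = (t \<otimes> s) \<otimes> y" if "t \<in> carrier S" for t
    using that assms by (simp add: m_assoc)
  then show "PIdl x \<subseteq> PIdl y"
    using \<open>s \<in> carrier S\<close> unfolding cgenideal_def by blast
qed

lemma semiring_ideal_cgenideal:
  assumes "x \<in> carrier S"
  shows "semiring_ideal (PIdl x) S"
  unfolding semiring_ideal_def
proof (intro conjI ballI)
  show "PIdl x \<subseteq> carrier S" "PIdl x \<noteq> {}"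
    using assms by (auto simp: cgenideal_def)
  show "y \<oplus> z \<in> PIdl x" if "y \<in> PIdl x" "z \<in> PIdl x" for y z
    using that assms l_distr[of _ _ x, symmetric] unfolding cgenideal_def by fastforce
  show "s \<otimes> y \<in> PIdl x" if "s \<in> carrier S" "y \<in> PIdl x" for s y
    using that assms m_assoc[of s _ x, symmetric] unfolding cgenideal_def by fastforce
qed

lemma ideals_chain_iff_cgenideals_chain:
  "(\<forall>I J. semiring_ideal I S \<and> semiring_ideal J S \<longrightarrow> I \<subseteq> J \<or> J \<subseteq> I) \<longleftrightarrow>
   (\<forall>x\<in>carrier S. \<forall>y\<in>carrier S. PIdl x \<subseteq> PIdl y \<or> PIdl y \<subseteq> PIdl x)"
proof
  assume "\<forall>I J. semiring_ideal I S \<and> semiring_ideal J S \<longrightarrow> I \<subseteq> J \<or> J \<subseteq> I"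
  then show "\<forall>x\<in>carrier S. \<forall>y\<in>carrier S. PIdl x \<subseteq> PIdl y \<or> PIdl y \<subseteq> PIdl x"
    by (simp add: semiring_ideal_cgenideal)
next
  assume chain: "\<forall>x\<in>carrier S. \<forall>y\<in>carrier S. PIdl x \<subseteq> PIdl y \<or> PIdl y \<subseteq> PIdl x"
  have "J \<subseteq> I" if I: "semiring_ideal I S" and J: "semiring_ideal J S" and "\<not> I \<subseteq> J" for I J
  proof
    fix y assume "y \<in> J"
    obtain x where "x \<in> I" "x \<notin> J"
      using \<open>\<not> I \<subseteq> J\<close> by blast
    have car: "x \<in> carrier S" "y \<in> carrier S"
      using I J \<open>x \<in> I\<close> \<open>y \<in> J\<close> by (auto simp: semiring_ideal_def)
    have "\<not> PIdl x \<subseteq> PIdl y"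
      using car J \<open>y \<in> J\<close> \<open>x \<notin> J\<close> by (auto simp: cgenideal_subset_iff semiring_ideal_def)
    then have "PIdl y \<subseteq> PIdl x"
      using chain car by blast
    then show "y \<in> I"
      using car I \<open>x \<in> I\<close> by (auto simp: cgenideal_subset_iff semiring_ideal_def)
  qed
  then show "\<forall>I J. semiring_ideal I S \<and> semiring_ideal J S \<longrightarrow> I \<subseteq> J \<or> J \<subseteq> I"
    by blast
qed

end

section \<open>The semifield of fractions\<close>

context mc_semiring
begin

lemma mult_eq_zero_iff [simp]:
  assumes "a \<in> carrier S" and "b \<in> carrier S"
  shows "a \<otimes> b = \<zero> \<longleftrightarrow> a = \<zero> \<or> b = \<zero>"
  using assms mult_cancel[of a b \<zero>] by auto

declare one_not_zero [simp]

text \<open>Transitivity is where cancellation enters: the middle denominator is a common factor.\<close>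
lemma equiv_fract_rel: "equiv (carrier S \<times> (carrier S - {\<zero>})) (fract_rel S)"
proof (rule equivI)
  show "fract_rel S \<subseteq> (carrier S \<times> (carrier S - {\<zero>})) \<times> (carrier S \<times> (carrier S - {\<zero>}))"
    by (auto simp: fract_rel_def)
  show "refl_on (carrier S \<times> (carrier S - {\<zero>})) (fract_rel S)"
    by (auto simp: refl_on_def fract_rel_def)
  show "sym (fract_rel S)"
    by (auto simp: sym_def fract_rel_def)
  show "trans (fract_rel S)"
  proof (rule transI, clarsimp simp: fract_rel_def)
    fix a b c d e f
    assume car: "a \<in> carrier S" "b \<in> carrier S" "c \<in> carrier S" "d \<in> carrier S"
        "e \<in> carrier S" "f \<in> carrier S"
      and "d \<noteq> \<zero>" and eq: "a \<otimes> d = c \<otimes> b" "c \<otimes> f = e \<otimes> d"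
    have "d \<otimes> (a \<otimes> f) = (a \<otimes> d) \<otimes> f"
      using car by (simp add: m_ac)
    also have "\<dots> = (c \<otimes> f) \<otimes> b"
      using car by (simp add: eq(1) m_ac)
    also have "\<dots> = d \<otimes> (e \<otimes> b)"
      using car by (simp add: eq(2) m_ac)
    finally show "a \<otimes> f = e \<otimes> b"
      using car \<open>d \<noteq> \<zero>\<close> mult_cancel[of d "a \<otimes> f" "e \<otimes> b"] by simp
  qed
qed

lemma fract_eq_iff:
  assumes "a \<in> carrier S" "b \<in> carrier S" "b \<noteq> \<zero>" "c \<in> carrier S" "d \<in> carrier S" "d \<noteq> \<zero>"
  shows "fract S a b = fract S c d \<longleftrightarrow> a \<otimes> d = c \<otimes> b"
  using assms eq_equiv_class_iff[OF equiv_fract_rel, of "(a, b)" "(c, d)"]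
  by (simp add: fract_def fract_rel_def)

lemma mem_fract_iff:
  assumes "a \<in> carrier S" "b \<in> carrier S" "b \<noteq> \<zero>"
  shows "(c, d) \<in> fract S a b \<longleftrightarrow>
    c \<in> carrier S \<and> d \<in> carrier S \<and> d \<noteq> \<zero> \<and> a \<otimes> d = c \<otimes> b"
  using assms by (auto simp: fract_def fract_rel_def)

lemma fract_closed [simp]:
  "a \<in> carrier S \<Longrightarrow> b \<in> carrier S \<Longrightarrow> b \<noteq> \<zero> \<Longrightarrow> fract S a b \<in> carrier (fract_semifield S)"
  by (auto simp: fract_semifield_def fract_def intro: quotientI)

lemma fract_cases:
  assumes "x \<in> carrier (fract_semifield S)"
  obtains a b where "a \<in> carrier S" "b \<in> carrier S" "b \<noteq> \<zero>" "x = fract S a b"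
  using assms that unfolding fract_semifield_def fract_def by (auto elim!: quotientE)

lemma fract_zero: "\<zero>\<^bsub>fract_semifield S\<^esub> = fract S \<zero> \<one>"
  and fract_one: "\<one>\<^bsub>fract_semifield S\<^esub> = fract S \<one> \<one>"
  by (simp_all add: fract_semifield_def)

text \<open>The operations on fractions are unions over all representatives of both arguments.  Such a union
  collapses as soon as its members agree, because every fraction has a representative.\<close>
lemma UN_fract2_eq:
  assumes "a \<in> carrier S" "b \<in> carrier S" "b \<noteq> \<zero>" "c \<in> carrier S" "d \<in> carrier S" "d \<noteq> \<zero>"
    and const: "\<And>a' b' c' d'. (a', b') \<in> fract S a b \<Longrightarrow> (c', d') \<in> fract S c d \<Longrightarrow> f a' b' c' d' = A"
  shows "(\<Union>(a, b)\<in>fract S a b. \<Union>(c, d)\<in>fract S c d. f a b c d) = A"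
proof -
  have "(a, b) \<in> fract S a b" "(c, d) \<in> fract S c d"
    using assms by (simp_all add: mem_fract_iff)
  then show ?thesis
    using const by fast
qed

lemma fract_mult:
  assumes "a \<in> carrier S" "b \<in> carrier S" "b \<noteq> \<zero>" "c \<in> carrier S" "d \<in> carrier S" "d \<noteq> \<zero>"
  shows "fract S a b \<otimes>\<^bsub>fract_semifield S\<^esub> fract S c d = fract S (a \<otimes> c) (b \<otimes> d)"
proof -
  have "fract S (a' \<otimes> c') (b' \<otimes> d') = fract S (a \<otimes> c) (b \<otimes> d)"
    if "(a', b') \<in> fract S a b" "(c', d') \<in> fract S c d" for a' b' c' d'
  proof -
    have mem: "a' \<in> carrier S" "b' \<in> carrier S" "b' \<noteq> \<zero>" "c' \<in> carrier S" "d' \<in> carrier S" "d' \<noteq> \<zero>"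
      and eq: "a \<otimes> b' = a' \<otimes> b" "c \<otimes> d' = c' \<otimes> d"
      using that assms by (simp_all add: mem_fract_iff)
    have "(a' \<otimes> c') \<otimes> (b \<otimes> d) = (a' \<otimes> b) \<otimes> (c' \<otimes> d)"
      using assms mem by (simp add: m_ac)
    also have "\<dots> = (a \<otimes> c) \<otimes> (b' \<otimes> d')"
      unfolding eq[symmetric] using assms mem by (simp add: m_ac)
    finally show ?thesis
      using assms mem by (simp add: fract_eq_iff)
  qed
  then show ?thesis
    unfolding fract_semifield_def by (simp add: UN_fract2_eq[OF assms])
qed

lemma fract_add:
  assumes "a \<in> carrier S" "b \<in> carrier S" "b \<noteq> \<zero>" "c \<in> carrier S" "d \<in> carrier S" "d \<noteq> \<zero>"
  shows "fract S a b \<oplus>\<^bsub>fract_semifield S\<^esub> fract S c d = fract S (a \<otimes> d \<oplus> c \<otimes> b) (b \<otimes> d)"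
proof -
  have "fract S (a' \<otimes> d' \<oplus> c' \<otimes> b') (b' \<otimes> d') = fract S (a \<otimes> d \<oplus> c \<otimes> b) (b \<otimes> d)"
    if "(a', b') \<in> fract S a b" "(c', d') \<in> fract S c d" for a' b' c' d'
  proof -
    have mem: "a' \<in> carrier S" "b' \<in> carrier S" "b' \<noteq> \<zero>" "c' \<in> carrier S" "d' \<in> carrier S" "d' \<noteq> \<zero>"
      and eq: "a \<otimes> b' = a' \<otimes> b" "c \<otimes> d' = c' \<otimes> d"
      using that assms by (simp_all add: mem_fract_iff)
    have "(a' \<otimes> d' \<oplus> c' \<otimes> b') \<otimes> (b \<otimes> d) = (a' \<otimes> b) \<otimes> (d' \<otimes> d) \<oplus> (c' \<otimes> d) \<otimes> (b' \<otimes> b)"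
      using assms mem by (simp add: m_ac l_distr r_distr)
    also have "\<dots> = (a \<otimes> d \<oplus> c \<otimes> b) \<otimes> (b' \<otimes> d')"
      unfolding eq[symmetric] using assms mem by (simp add: m_ac l_distr r_distr)
    finally show ?thesis
      using assms mem by (simp add: fract_eq_iff)
  qed
  then show ?thesis
    unfolding fract_semifield_def by (simp add: UN_fract2_eq[OF assms])
qed

lemma fract_mult_inverse:
  assumes "a \<in> carrier S" "a \<noteq> \<zero>" "b \<in> carrier S" "b \<noteq> \<zero>"
  shows "fract S a b \<otimes>\<^bsub>fract_semifield S\<^esub> fract S b a = \<one>\<^bsub>fract_semifield S\<^esub>"
  using assms by (simp add: fract_mult fract_one fract_eq_iff m_comm)

lemma fract_eq_zero_iff:
  assumes "a \<in> carrier S" "b \<in> carrier S" "b \<noteq> \<zero>"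
  shows "fract S a b = \<zero>\<^bsub>fract_semifield S\<^esub> \<longleftrightarrow> a = \<zero>"
  using assms by (simp add: fract_zero fract_eq_iff)

lemma abelian_monoid_fract: "abelian_monoid (fract_semifield S)"
proof (rule abelian_monoidI)
  let ?F = "fract_semifield S"
  show "x \<oplus>\<^bsub>?F\<^esub> y \<oplus>\<^bsub>?F\<^esub> z = x \<oplus>\<^bsub>?F\<^esub> (y \<oplus>\<^bsub>?F\<^esub> z)"
    if "x \<in> carrier ?F" "y \<in> carrier ?F" "z \<in> carrier ?F" for x y z
    using that by (elim fract_cases) (simp add: fract_add fract_eq_iff l_distr r_distr m_ac a_ac)
qed (auto elim!: fract_cases simp: fract_add fract_zero fract_eq_iff m_ac a_ac)

lemma comm_monoid_fract: "comm_monoid (fract_semifield S)"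
  by (rule comm_monoidI) (auto elim!: fract_cases simp: fract_mult fract_one fract_eq_iff m_ac)

lemma semifield_fract_semifield: "semifield (fract_semifield S)"
proof -
  let ?F = "fract_semifield S"
  interpret F: abelian_monoid ?F by (rule abelian_monoid_fract)
  interpret F: comm_monoid ?F by (rule comm_monoid_fract)
  have distr: "(x \<oplus>\<^bsub>?F\<^esub> y) \<otimes>\<^bsub>?F\<^esub> z = x \<otimes>\<^bsub>?F\<^esub> z \<oplus>\<^bsub>?F\<^esub> y \<otimes>\<^bsub>?F\<^esub> z"
    if "x \<in> carrier ?F" "y \<in> carrier ?F" "z \<in> carrier ?F" for x y z
    using that by (elim fract_cases) (simp add: fract_add fract_mult fract_eq_iff l_distr r_distr m_ac)
  have null: "\<zero>\<^bsub>?F\<^esub> \<otimes>\<^bsub>?F\<^esub> x = \<zero>\<^bsub>?F\<^esub>" if "x \<in> carrier ?F" for x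
    using that by (elim fract_cases) (simp add: fract_zero fract_mult fract_eq_iff)
  show ?thesis
  proof
    show "z \<otimes>\<^bsub>?F\<^esub> (x \<oplus>\<^bsub>?F\<^esub> y) = z \<otimes>\<^bsub>?F\<^esub> x \<oplus>\<^bsub>?F\<^esub> z \<otimes>\<^bsub>?F\<^esub> y"
      if "x \<in> carrier ?F" "y \<in> carrier ?F" "z \<in> carrier ?F" for x y z
      using that distr[of x y z] by (simp add: F.m_comm)
    show "x \<otimes>\<^bsub>?F\<^esub> \<zero>\<^bsub>?F\<^esub> = \<zero>\<^bsub>?F\<^esub>" if "x \<in> carrier ?F" for x
      using that null[of x] by (simp add: F.m_comm)
    show "\<one>\<^bsub>?F\<^esub> \<noteq> \<zero>\<^bsub>?F\<^esub>"
      by (simp add: fract_one fract_eq_zero_iff)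
    show "x \<in> Units ?F" if x: "x \<in> carrier ?F" "x \<noteq> \<zero>\<^bsub>?F\<^esub>" for x
    proof -
      obtain a b where "a \<in> carrier S" "a \<noteq> \<zero>" "b \<in> carrier S" "b \<noteq> \<zero>" "x = fract S a b"
        using x by (metis fract_cases fract_eq_zero_iff)
      then have "fract S b a \<in> carrier ?F" "x \<otimes>\<^bsub>?F\<^esub> fract S b a = \<one>\<^bsub>?F\<^esub>"
        by (auto simp: fract_mult_inverse)
      with x show ?thesis
        using F.m_comm[of x "fract S b a"] by (auto simp: Units_def)
    qed
  qed (use distr null in auto)
qed

lemma inv_fract:
  assumes "a \<in> carrier S" "a \<noteq> \<zero>" "b \<in> carrier S" "b \<noteq> \<zero>"
  shows "inv\<^bsub>fract_semifield S\<^esub> (fract S a b) = fract S b a"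
  using assms fract_mult_inverse
  by (intro comm_monoid.comm_inv_char[OF comm_monoid_fract]) auto

lemma fract_embed_embedding: "fract_embed S \<in> semiring_embedding S (fract_semifield S)"
  by (auto simp: semiring_embedding_def fract_embed_def fract_mult fract_add fract_one fract_zero
      fract_eq_iff inj_on_def intro!: ring_hom_memI)

lemma fract_mem_embed_iff:
  assumes "a \<in> carrier S" "b \<in> carrier S" "b \<noteq> \<zero>"
  shows "fract S a b \<in> fract_embed S ` carrier S \<longleftrightarrow> (\<exists>s\<in>carrier S. a = s \<otimes> b)"
  using assms by (auto simp: fract_embed_def image_iff fract_eq_iff)

end

text \<open>A fraction and its inverse ask for opposite divisibilities between numerator and denominator.  Zero,
  which the condition on fractions leaves out, is divisible by everything.\<close>
lemma (in mc_semiring) fract_or_inv_iff_cgenideals_chain: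
  "(\<forall>x \<in> carrier (fract_semifield S). x \<noteq> \<zero>\<^bsub>fract_semifield S\<^esub> \<longrightarrow>
      x \<in> fract_embed S ` carrier S \<or> inv\<^bsub>fract_semifield S\<^esub> x \<in> fract_embed S ` carrier S) \<longleftrightarrow>
   (\<forall>x\<in>carrier S. \<forall>y\<in>carrier S. PIdl x \<subseteq> PIdl y \<or> PIdl y \<subseteq> PIdl x)" (is "?L \<longleftrightarrow> ?R")
proof
  assume L: ?L
  show ?R
  proof (intro ballI)
    fix x y assume car: "x \<in> carrier S" "y \<in> carrier S"
    show "PIdl x \<subseteq> PIdl y \<or> PIdl y \<subseteq> PIdl x"
    proof (cases "x = \<zero> \<or> y = \<zero>")
      case True
      then have "x = \<zero> \<otimes> y \<or> y = \<zero> \<otimes> x"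
        using car by auto
      then show ?thesis
        unfolding cgenideal_subset_iff[OF car] cgenideal_subset_iff[OF car(2,1)] by blast
    next
      case False
      then show ?thesis
        using L[rule_format, of "fract S x y"] car
        by (simp add: fract_eq_zero_iff inv_fract fract_mem_embed_iff cgenideal_subset_iff)
    qed
  qed
next
  assume R: ?R
  show ?L
  proof (intro ballI impI)
    fix x assume x: "x \<in> carrier (fract_semifield S)" "x \<noteq> \<zero>\<^bsub>fract_semifield S\<^esub>"
    then obtain a b where ab: "a \<in> carrier S" "a \<noteq> \<zero>" "b \<in> carrier S" "b \<noteq> \<zero>" "x = fract S a b"
      by (metis fract_cases fract_eq_zero_iff)
    then show "x \<in> fract_embed S ` carrier S \<or> inv\<^bsub>fract_semifield S\<^esub> x \<in> fract_embed S ` carrier S"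
      using R by (simp add: inv_fract fract_mem_embed_iff cgenideal_subset_iff)
  qed
qed

section \<open>Principal ideals of a valuation semiring\<close>

lemma (in comm_monoid) inv_mult_units:
  "x \<in> Units G \<Longrightarrow> y \<in> carrier G \<Longrightarrow> y \<otimes> inv x \<otimes> x = y"
  by (simp add: m_assoc Units_closed)

lemma adjoin_infinity_simps:
  "(Some a, Some b) \<in> leq (adjoin_infinity M) \<longleftrightarrow> (a, b) \<in> leq M"
  "(None, Some b) \<notin> leq (adjoin_infinity M)"
  "(x, None) \<in> leq (adjoin_infinity M) \<longleftrightarrow> x \<in> carrier (adjoin_infinity M)"
  "Some a \<otimes>\<^bsub>adjoin_infinity M\<^esub> Some b = Some (a \<otimes>\<^bsub>M\<^esub> b)"
  "None \<otimes>\<^bsub>adjoin_infinity M\<^esub> y = None"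
  "x \<otimes>\<^bsub>adjoin_infinity M\<^esub> None = None"
  "\<one>\<^bsub>adjoin_infinity M\<^esub> = Some \<one>\<^bsub>M\<^esub>"
  "Some a \<in> carrier (adjoin_infinity M) \<longleftrightarrow> a \<in> carrier M"
  "None \<in> carrier (adjoin_infinity M)"
  by (auto simp: adjoin_infinity_def split: option.splits)

text \<open>Infinity is absorbing, so it has no inverse in \<open>M\<^sub>\<infinity>\<close>, whereas \<open>v (x\<inverse>)\<close> is inverse to \<open>v x\<close>.\<close>
lemma valuation_unit:
  assumes "valuation M K v" "x \<in> Units K"
  obtains m where "m \<in> carrier M" "v x = Some m"
proof -
  interpret K: commutative_semiring K
    using assms(1) by (rule valuation.axioms)
  interpret valuation M K v by fact
  have "v x \<otimes>\<^bsub>adjoin_infinity M\<^esub> v (inv\<^bsub>K\<^esub> x) = \<one>\<^bsub>adjoin_infinity M\<^esub>"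
    using assms val_mult[of x "inv\<^bsub>K\<^esub> x"] by (simp add: val_one K.Units_closed)
  then have "v x \<noteq> None"
    by (cases "v x") (auto simp: adjoin_infinity_simps)
  moreover have "v x \<in> carrier (adjoin_infinity M)"
    using val_closed assms by (auto simp: K.Units_closed)
  ultimately show thesis
    using that by (cases "v x") (auto simp: adjoin_infinity_simps)
qed

text \<open>Adding \<open>v (x\<inverse>)\<close> to both sides of \<open>v x \<le> v y\<close> turns the left side into \<open>0\<close>.\<close>
lemma valuation_divide_mem_nonneg_part:
  assumes "valuation M K v" "x \<in> Units K" "y \<in> Units K" "(v x, v y) \<in> leq (adjoin_infinity M)"
  shows "y \<otimes>\<^bsub>K\<^esub> inv\<^bsub>K\<^esub> x \<in> nonneg_part M K v"
proof -
  interpret K: commutative_semiring K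
    using assms(1) by (rule valuation.axioms)
  interpret valuation M K v by fact
  obtain a b c where val: "v x = Some a" "v y = Some b" "v (inv\<^bsub>K\<^esub> x) = Some c"
    and car: "a \<in> carrier M" "b \<in> carrier M" "c \<in> carrier M"
    using valuation_unit[OF assms(1)] assms(2,3) by (metis K.Units_inv_Units)
  have "a \<otimes>\<^bsub>M\<^esub> c = \<one>\<^bsub>M\<^esub>"
    using assms val_mult[of x "inv\<^bsub>K\<^esub> x"]
    by (simp add: K.Units_closed val val_one adjoin_infinity_simps)
  then have "(\<one>\<^bsub>M\<^esub>, b \<otimes>\<^bsub>M\<^esub> c) \<in> leq M"
    using leq_mono[of a b c] assms(4) car by (simp add: val adjoin_infinity_simps)
  then show ?thesis
    using assms by (simp add: nonneg_part_def val_mult K.Units_closed K.Units_inv_closed val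
        adjoin_infinity_simps)
qed

text \<open>The quotient of the element of larger value by the one of smaller value lies in the image of \<open>S\<close>, and injectivity of the
  embedding turns this into divisibility in \<open>S\<close>.\<close>
lemma valuation_semiring_in_cgenideals_chain:
  fixes S :: "('a, 'x) ring_scheme"
  assumes "valuation_semiring_in TYPE('k) TYPE('m) S" "x \<in> carrier S" "y \<in> carrier S"
  shows "PIdl\<^bsub>S\<^esub> x \<subseteq> PIdl\<^bsub>S\<^esub> y \<or> PIdl\<^bsub>S\<^esub> y \<subseteq> PIdl\<^bsub>S\<^esub> x"
proof -
  obtain K :: "'k ring" and M :: "'m tomonoid" and v h
    where "commutative_semiring S" "semifield K" "valuation M K v"
      and h: "h \<in> semiring_embedding S K" and img: "h ` carrier S = nonneg_part M K v"
    using assms(1) by (auto simp: valuation_semiring_in_def)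
  interpret S: commutative_semiring S by fact
  interpret K: semifield K by fact
  interpret valuation M K v by fact
  have hom: "h \<in> ring_hom S K" and inj: "inj_on h (carrier S)" and h0: "h \<zero>\<^bsub>S\<^esub> = \<zero>\<^bsub>K\<^esub>"
    using h by (auto simp: semiring_embedding_def)
  note hom_simps = ring_hom_closed[OF hom] ring_hom_mult[OF hom]
  have divides: "\<exists>s\<in>carrier S. y = s \<otimes>\<^bsub>S\<^esub> x"
    if car: "x \<in> carrier S" "y \<in> carrier S" and units: "h x \<in> Units K" "h y \<in> Units K"
      and le: "(v (h x), v (h y)) \<in> leq (adjoin_infinity M)" for x y
  proof -
    obtain s where s: "s \<in> carrier S" "h y \<otimes>\<^bsub>K\<^esub> inv\<^bsub>K\<^esub> (h x) = h s"
      using valuation_divide_mem_nonneg_part[OF \<open>valuation M K v\<close> units le] img by (metis imageE)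
    have "h y = h (s \<otimes>\<^bsub>S\<^esub> x)"
      using car units s(1) K.inv_mult_units[of "h x" "h y"] by (simp add: hom_simps s(2))
    then have "y = s \<otimes>\<^bsub>S\<^esub> x"
      using inj car s(1) by (simp add: inj_on_eq_iff)
    then show ?thesis
      using s(1) by blast
  qed
  show ?thesis
  proof (cases "x = \<zero>\<^bsub>S\<^esub> \<or> y = \<zero>\<^bsub>S\<^esub>")
    case True
    then have "x = \<zero>\<^bsub>S\<^esub> \<otimes>\<^bsub>S\<^esub> y \<or> y = \<zero>\<^bsub>S\<^esub> \<otimes>\<^bsub>S\<^esub> x"
      using assms by auto
    then show ?thesis
      unfolding S.cgenideal_subset_iff[OF assms(2,3)] S.cgenideal_subset_iff[OF assms(3,2)] by blast
  next
    case False
    then have "h x \<noteq> \<zero>\<^bsub>K\<^esub>" "h y \<noteq> \<zero>\<^bsub>K\<^esub>"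
      using inj assms h0 by (metis inj_on_eq_iff S.zero_closed)+
    then have units: "h x \<in> Units K" "h y \<in> Units K"
      using assms K.nonzero_Units by (simp_all add: hom_simps)
    then obtain a b where "v (h x) = Some a" "v (h y) = Some b" "a \<in> carrier M" "b \<in> carrier M"
      by (metis valuation_unit[OF \<open>valuation M K v\<close>])
    then have "(v (h x), v (h y)) \<in> leq (adjoin_infinity M) \<or> (v (h y), v (h x)) \<in> leq (adjoin_infinity M)"
      using leq_linear
      by (auto simp: adjoin_infinity_simps linear_order_on_def partial_order_on_def
          preorder_on_def total_on_def refl_on_def) metis
    then show ?thesis
      using divides assms(2,3) units by (auto simp: S.cgenideal_subset_iff)
  qed
qed

section \<open>The valuation of a total subsemiring\<close>

text \<open>The cosets \<open>A x\<close> are the principal fractional ideals of \<open>A\<close>.  The order is reverse inclusion, since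
  \<open>x\<close> is to have at most the value of \<open>y\<close> iff it divides \<open>y\<close>.\<close>
definition value_monoid :: "('k, 'x) ring_scheme \<Rightarrow> 'k set \<Rightarrow> 'k set tomonoid" where
  "value_monoid K A =
     \<lparr>carrier = {A #>\<^bsub>K\<^esub> x | x. x \<in> carrier K \<and> x \<noteq> \<zero>\<^bsub>K\<^esub>},
      monoid.mult = set_mult K,
      one = A,
      leq = {(A #>\<^bsub>K\<^esub> x, A #>\<^bsub>K\<^esub> y) | x y.
        x \<in> carrier K \<and> x \<noteq> \<zero>\<^bsub>K\<^esub> \<and> y \<in> carrier K \<and> y \<noteq> \<zero>\<^bsub>K\<^esub> \<and> A #>\<^bsub>K\<^esub> y \<subseteq> A #>\<^bsub>K\<^esub> x}\<rparr>"

definition value_map :: "('k, 'x) ring_scheme \<Rightarrow> 'k set \<Rightarrow> 'k \<Rightarrow> 'k set option" where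
  "value_map K A x = (if x = \<zero>\<^bsub>K\<^esub> then None else Some (A #>\<^bsub>K\<^esub> x))"

locale total_subsemiring = semifield K for K (structure) +
  fixes A
  assumes A_subset: "A \<subseteq> carrier K"
    and zero_mem: "\<zero> \<in> A"
    and one_mem: "\<one> \<in> A"
    and add_mem: "\<lbrakk>a \<in> A; b \<in> A\<rbrakk> \<Longrightarrow> a \<oplus> b \<in> A"
    and mult_mem: "\<lbrakk>a \<in> A; b \<in> A\<rbrakk> \<Longrightarrow> a \<otimes> b \<in> A"
    and mem_or_inv_mem: "\<lbrakk>x \<in> carrier K; x \<noteq> \<zero>\<rbrakk> \<Longrightarrow> x \<in> A \<or> inv x \<in> A"
begin

lemma inv_nonzero:
  assumes "x \<in> carrier K" "x \<noteq> \<zero>"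
  shows "inv x \<in> carrier K" "inv x \<noteq> \<zero>" "x \<otimes> inv x = \<one>" "inv x \<otimes> x = \<one>"
proof -
  have "x \<in> Units K"
    using assms nonzero_Units by blast
  then show "inv x \<in> carrier K" "x \<otimes> inv x = \<one>" "inv x \<otimes> x = \<one>"
    by auto
  then show "inv x \<noteq> \<zero>"
    using assms one_not_zero by auto
qed

lemma mult_eq_zero_iff [simp]:
  assumes "x \<in> carrier K" "y \<in> carrier K"
  shows "x \<otimes> y = \<zero> \<longleftrightarrow> x = \<zero> \<or> y = \<zero>"
proof -
  have "y = \<zero>" if "x \<otimes> y = \<zero>" "x \<noteq> \<zero>"
    using assms that inv_nonzero[of x] m_assoc[of "inv x" x y] by simp
  then show ?thesis
    using assms by auto
qed

lemma coset_subset_iff: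
  assumes "x \<in> carrier K" "y \<in> carrier K"
  shows "A #> y \<subseteq> A #> x \<longleftrightarrow> (\<exists>a\<in>A. y = a \<otimes> x)"
proof
  assume "A #> y \<subseteq> A #> x"
  moreover have "\<one> \<otimes> y \<in> A #> y"
    using one_mem unfolding r_coset_def by blast
  ultimately show "\<exists>a\<in>A. y = a \<otimes> x"
    using assms by (auto simp: r_coset_def)
next
  assume "\<exists>a\<in>A. y = a \<otimes> x"
  then obtain a where a: "a \<in> A" "y = a \<otimes> x" by blast
  then have "b \<otimes> y = (b \<otimes> a) \<otimes> x" if "b \<in> A" for b
    using that assms A_subset by (auto simp: m_assoc subset_iff)
  then show "A #> y \<subseteq> A #> x"
    using a mult_mem unfolding r_coset_def by blast
qed

lemma coset_one: "A #> \<one> = A"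
  using A_subset by (force simp: r_coset_def)

text \<open>The inclusion from right to left uses \<open>1 \<in> A\<close>: an element \<open>a (x y)\<close> is \<open>(a x) (1 y)\<close>.\<close>
lemma coset_set_mult:
  assumes "x \<in> carrier K" "y \<in> carrier K"
  shows "(A #> x) <#> (A #> y) = A #> (x \<otimes> y)"
proof
  have eq: "(a \<otimes> x) \<otimes> (b \<otimes> y) = (a \<otimes> b) \<otimes> (x \<otimes> y)" if "a \<in> A" "b \<in> A" for a b
    using that assms A_subset by (auto simp: m_ac subset_iff)
  then show "(A #> x) <#> (A #> y) \<subseteq> A #> (x \<otimes> y)"
    using mult_mem by (fastforce simp: set_mult_def r_coset_def)
  show "A #> (x \<otimes> y) \<subseteq> (A #> x) <#> (A #> y)"
  proof
    fix z assume "z \<in> A #> (x \<otimes> y)"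
    then obtain a where a: "a \<in> A" "z = a \<otimes> (x \<otimes> y)"
      by (auto simp: r_coset_def)
    then have "z = (a \<otimes> x) \<otimes> (\<one> \<otimes> y)"
      using assms A_subset by (auto simp: m_assoc subset_iff)
    then show "z \<in> (A #> x) <#> (A #> y)"
      using a one_mem unfolding set_mult_def r_coset_def by blast
  qed
qed

text \<open>This is where totality of \<open>A\<close> enters, applied to the quotient of \<open>x\<close> by \<open>y\<close>, whose inverse is the
  quotient of \<open>y\<close> by \<open>x\<close>.\<close>
lemma cosets_chain:
  assumes "x \<in> carrier K" "x \<noteq> \<zero>" "y \<in> carrier K" "y \<noteq> \<zero>"
  shows "A #> x \<subseteq> A #> y \<or> A #> y \<subseteq> A #> x"
proof -
  have quot: "u = (u \<otimes> inv w) \<otimes> w" if "u \<in> carrier K" "w \<in> carrier K" "w \<noteq> \<zero>" for u w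
    using that by (simp add: m_assoc inv_nonzero)
  have "(x \<otimes> inv y) \<otimes> (y \<otimes> inv x) = (x \<otimes> inv x) \<otimes> (y \<otimes> inv y)"
    using assms by (simp add: inv_nonzero(1) m_ac)
  then have "inv (x \<otimes> inv y) = y \<otimes> inv x"
    using assms by (intro comm_inv_char) (simp_all add: inv_nonzero)
  then have "x \<otimes> inv y \<in> A \<or> y \<otimes> inv x \<in> A"
    using mem_or_inv_mem[of "x \<otimes> inv y"] assms by (simp add: inv_nonzero)
  then show ?thesis
    using assms quot[of x y] quot[of y x] by (auto simp: coset_subset_iff)
qed

abbreviation M :: "'a set tomonoid" where "M \<equiv> value_monoid K A"

lemma value_monoid_simps [simp]:
  "carrier M = {A #> x | x. x \<in> carrier K \<and> x \<noteq> \<zero>}"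
  "monoid.mult M = set_mult K"
  "one M = A"
  by (simp_all add: value_monoid_def)

lemma leq_value_monoid_iff:
  "(P, Q) \<in> leq M \<longleftrightarrow> P \<in> carrier M \<and> Q \<in> carrier M \<and> Q \<subseteq> P"
  by (auto simp: value_monoid_def)

lemma coset_mem_value_monoid: "x \<in> carrier K \<Longrightarrow> x \<noteq> \<zero> \<Longrightarrow> A #> x \<in> carrier M"
  by auto

lemma tomonoid_value_monoid: "tomonoid M"
proof -
  have "comm_monoid M"
  proof (rule comm_monoidI)
    show "\<one>\<^bsub>M\<^esub> \<in> carrier M"
      using coset_one one_not_zero by force
    show "P \<otimes>\<^bsub>M\<^esub> Q \<in> carrier M" if "P \<in> carrier M" "Q \<in> carrier M" for P Q
      using that by (auto simp: coset_set_mult)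
    show "P \<otimes>\<^bsub>M\<^esub> Q \<otimes>\<^bsub>M\<^esub> R = P \<otimes>\<^bsub>M\<^esub> (Q \<otimes>\<^bsub>M\<^esub> R)"
      if "P \<in> carrier M" "Q \<in> carrier M" "R \<in> carrier M" for P Q R
      using that by (clarsimp simp: coset_set_mult m_assoc)
    show "P \<otimes>\<^bsub>M\<^esub> Q = Q \<otimes>\<^bsub>M\<^esub> P" if "P \<in> carrier M" "Q \<in> carrier M" for P Q
      using that by (clarsimp simp: coset_set_mult m_comm)
    show "\<one>\<^bsub>M\<^esub> \<otimes>\<^bsub>M\<^esub> P = P" if "P \<in> carrier M" for P
      using that coset_set_mult[of \<one>] by (clarsimp simp: coset_one)
  qed
  then interpret M: comm_monoid M .
  have chain: "P \<subseteq> Q \<or> Q \<subseteq> P" if "P \<in> carrier M" "Q \<in> carrier M" for P Q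
    using that cosets_chain by auto
  show ?thesis
  proof
    show "linear_order_on (carrier M) (leq M)"
      unfolding linear_order_on_def partial_order_on_def preorder_on_def
    proof (intro conjI)
      show "leq M \<subseteq> carrier M \<times> carrier M" "refl_on (carrier M) (leq M)"
        by (auto simp: refl_on_def leq_value_monoid_iff simp del: value_monoid_simps(1))
      show "trans (leq M)" "antisym (leq M)"
        by (auto simp: trans_def antisym_def leq_value_monoid_iff simp del: value_monoid_simps(1))
      show "total_on (carrier M) (leq M)"
        using chain unfolding total_on_def leq_value_monoid_iff by blast
    qed
    show "(P \<otimes>\<^bsub>M\<^esub> R, Q \<otimes>\<^bsub>M\<^esub> R) \<in> leq M" if "(P, Q) \<in> leq M" "R \<in> carrier M" for P Q R
      using that M.m_closed mono_set_mult[of Q P R R K]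
      by (simp add: leq_value_monoid_iff del: value_monoid_simps(1))
  qed
qed

text \<open>If \<open>A g\<close> is a greatest value, then comparison of \<open>A g\<close> with
  \<open>A (g x\<inverse>)\<close> puts every nonzero \<open>x\<close> into \<open>A\<close>; as this applies to \<open>x\<inverse>\<close> too, all values equal \<open>A\<close>.\<close>
lemma value_monoid_no_greatest_or_trivial:
  "(\<nexists>g. g \<in> carrier M \<and> (\<forall>P\<in>carrier M. (P, g) \<in> leq M)) \<or> carrier M = {\<one>\<^bsub>M\<^esub>}"
proof (cases "\<exists>g. g \<in> carrier M \<and> (\<forall>P\<in>carrier M. (P, g) \<in> leq M)")
  case True
  then obtain g where g: "g \<in> carrier K" "g \<noteq> \<zero>"
    and max: "\<And>x. x \<in> carrier K \<Longrightarrow> x \<noteq> \<zero> \<Longrightarrow> A #> g \<subseteq> A #> x"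
    by (auto simp: leq_value_monoid_iff)
  have mem: "x \<in> A" if x: "x \<in> carrier K" "x \<noteq> \<zero>" for x
  proof -
    obtain a where a: "a \<in> A" "g = a \<otimes> (g \<otimes> inv x)"
      using max[of "g \<otimes> inv x"] g x by (auto simp: coset_subset_iff inv_nonzero)
    have "x = inv g \<otimes> g \<otimes> x"
      using g x by (simp add: inv_nonzero)
    also have "\<dots> = inv g \<otimes> (a \<otimes> (g \<otimes> inv x)) \<otimes> x"
      using a(2) by simp
    also have "\<dots> = a \<otimes> ((inv g \<otimes> g) \<otimes> (inv x \<otimes> x))"
      using a(1) A_subset g x by (simp add: subset_iff inv_nonzero(1) m_ac)
    also have "\<dots> = a"
      using a(1) A_subset g x by (auto simp: inv_nonzero)
    finally show ?thesis
      using a(1) by simp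
  qed
  have "A #> x = A #> \<one>" if x: "x \<in> carrier K" "x \<noteq> \<zero>" for x
  proof
    show "A #> x \<subseteq> A #> \<one>"
      using x mem[of x] by (auto simp: coset_subset_iff intro!: bexI[of _ x])
    show "A #> \<one> \<subseteq> A #> x"
      using x mem[of "inv x"] inv_nonzero[of x] by (auto simp: coset_subset_iff intro!: bexI[of _ "inv x"])
  qed
  then have "carrier M = {A #> \<one>}"
    unfolding value_monoid_simps(1) using one_not_zero one_closed by blast
  then show ?thesis
    by (simp add: coset_one del: value_monoid_simps(1))
qed blast

text \<open>The element of smaller value divides the other one, hence also their sum.\<close>
lemma value_map_add_le:
  assumes "x \<in> carrier K" "x \<noteq> \<zero>" "y \<in> carrier K" "A #> y \<subseteq> A #> x"
  shows "(Some (A #> x), value_map K A (x \<oplus> y)) \<in> leq (adjoin_infinity M)"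
proof (cases "x \<oplus> y = \<zero>")
  case True
  have "A #> x \<in> carrier M"
    using assms by (intro coset_mem_value_monoid)
  with True show ?thesis
    by (simp add: value_map_def adjoin_infinity_simps del: value_monoid_simps(1))
next
  case False
  obtain a where a: "a \<in> A" "y = a \<otimes> x"
    using assms coset_subset_iff by blast
  then have "a \<in> carrier K"
    using A_subset by blast
  then have "x \<oplus> y = (\<one> \<oplus> a) \<otimes> x"
    using assms(1) by (simp add: a(2) l_distr)
  then have "A #> (x \<oplus> y) \<subseteq> A #> x"
    using assms add_mem[OF one_mem a(1)] coset_subset_iff[of x "x \<oplus> y"] by blast
  moreover have "A #> x \<in> carrier M" "A #> (x \<oplus> y) \<in> carrier M"
    using assms False by (intro coset_mem_value_monoid a_closed; simp)+
  ultimately show ?thesis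
    using False
    by (simp add: value_map_def adjoin_infinity_simps leq_value_monoid_iff
        del: value_monoid_simps(1))
qed

lemma valuation_value_map: "valuation M K (value_map K A)"
proof (intro valuation.intro valuation_axioms.intro)
  note inf_simps = adjoin_infinity_simps
  show "commutative_semiring K" "tomonoid M"
    by (rule commutative_semiring_axioms, rule tomonoid_value_monoid)
  show "(\<nexists>g. g \<in> carrier M \<and> (\<forall>x\<in>carrier M. (x, g) \<in> leq M)) \<or> carrier M = {\<one>\<^bsub>M\<^esub>}"
    by (rule value_monoid_no_greatest_or_trivial)
  show "value_map K A \<in> carrier K \<rightarrow> carrier (adjoin_infinity M)"
    by (auto simp: value_map_def inf_simps)
  show "value_map K A (x \<otimes> y) = value_map K A x \<otimes>\<^bsub>adjoin_infinity M\<^esub> value_map K A y"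
    if "x \<in> carrier K" "y \<in> carrier K" for x y
    using that by (simp add: value_map_def inf_simps coset_set_mult)
  show "value_map K A \<one> = \<one>\<^bsub>adjoin_infinity M\<^esub>"
    using one_not_zero by (simp add: value_map_def inf_simps coset_one)
  show "value_map K A \<zero> = None"
    by (simp add: value_map_def)
  show "(tomonoid_min (adjoin_infinity M) (value_map K A x) (value_map K A y),
      value_map K A (x \<oplus> y)) \<in> leq (adjoin_infinity M)"
    if xy: "x \<in> carrier K" "y \<in> carrier K" for x y
  proof (cases "x = \<zero> \<or> y = \<zero>")
    case True
    then show ?thesis
      using xy by (auto simp: tomonoid_min_def value_map_def inf_simps leq_value_monoid_iff)
  next
    case False
    then have val: "value_map K A x = Some (A #> x)" "value_map K A y = Some (A #> y)"
      by (simp_all add: value_map_def)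
    have mem: "A #> x \<in> carrier M" "A #> y \<in> carrier M"
      using False xy by (simp_all only: coset_mem_value_monoid de_Morgan_disj not_False_eq_True)
    show ?thesis
    proof (cases "A #> y \<subseteq> A #> x")
      case True
      then show ?thesis
        using False xy mem value_map_add_le[of x y]
        by (simp add: tomonoid_min_def val inf_simps leq_value_monoid_iff
            del: value_monoid_simps(1))
    next
      case not_le: False
      then have "A #> x \<subseteq> A #> y"
        using False xy cosets_chain by blast
      then show ?thesis
        using False xy not_le value_map_add_le[of y x] a_comm[of x y]
        by (simp add: tomonoid_min_def val inf_simps leq_value_monoid_iff
            del: value_monoid_simps(1))
    qed
  qed
qed

lemma value_map_surj: "value_map K A ` carrier K = carrier (adjoin_infinity M)"
proof -
  have "carrier (adjoin_infinity M) = insert None (Some ` carrier M)"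
    by (simp add: adjoin_infinity_def)
  then show ?thesis
    by (auto simp: value_map_def image_iff intro: bexI[of _ \<zero>])
qed

lemma nonneg_part_value_map: "nonneg_part M K (value_map K A) = A"
proof -
  have "(Some A, value_map K A x) \<in> leq (adjoin_infinity M) \<longleftrightarrow> x \<in> A" if x: "x \<in> carrier K" for x
  proof (cases "x = \<zero>")
    case True
    then show ?thesis
      using zero_mem coset_one one_not_zero
      by (auto simp: value_map_def adjoin_infinity_simps)
  next
    case False
    have "A #> x \<subseteq> A \<longleftrightarrow> x \<in> A"
      using coset_subset_iff[of \<one> x] x A_subset by (auto simp: coset_one subset_iff)
    moreover have "A \<in> carrier M"
      using coset_mem_value_monoid[of \<one>] one_not_zero by (simp add: coset_one del: value_monoid_simps)
    ultimately show ?thesis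
      using x False coset_mem_value_monoid[of x]
      by (simp add: value_map_def adjoin_infinity_simps leq_value_monoid_iff
          del: value_monoid_simps(1))
  qed
  then show ?thesis
    using A_subset by (auto simp: nonneg_part_def adjoin_infinity_simps)
qed

end

section \<open>The characterizations of valuation semirings\<close>

lemma (in mc_semiring) valuation_semiring_if_fract_or_inv:
  assumes "\<forall>x \<in> carrier (fract_semifield S). x \<noteq> \<zero>\<^bsub>fract_semifield S\<^esub> \<longrightarrow>
      x \<in> fract_embed S ` carrier S \<or> inv\<^bsub>fract_semifield S\<^esub> x \<in> fract_embed S ` carrier S"
  shows "valuation_semiring S"
proof -
  let ?F = "fract_semifield S" and ?A = "fract_embed S ` carrier S"
  interpret F: semifield ?F by (rule semifield_fract_semifield)
  have hom: "fract_embed S \<in> ring_hom S ?F" and zero: "fract_embed S \<zero> = \<zero>\<^bsub>?F\<^esub>"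
    using fract_embed_embedding by (auto simp: semiring_embedding_def)
  interpret F: total_subsemiring ?F ?A
  proof
    show "?A \<subseteq> carrier ?F"
      using ring_hom_closed[OF hom] by blast
    show "\<zero>\<^bsub>?F\<^esub> \<in> ?A" "\<one>\<^bsub>?F\<^esub> \<in> ?A"
      by (simp_all flip: zero ring_hom_one[OF hom])
    show "a \<oplus>\<^bsub>?F\<^esub> b \<in> ?A" "a \<otimes>\<^bsub>?F\<^esub> b \<in> ?A" if "a \<in> ?A" "b \<in> ?A" for a b
      using that by (auto simp: ring_hom_add[OF hom, symmetric] ring_hom_mult[OF hom, symmetric])
  qed (use assms in blast)
  show ?thesis
    unfolding valuation_semiring_def valuation_semiring_in_def
    using fract_embed_embedding F.nonneg_part_value_map
    by (intro conjI exI[of _ ?F] exI[of _ "value_monoid ?F ?A"] exI[of _ "value_map ?F ?A"]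
        exI[of _ "fract_embed S"] commutative_semiring_axioms F.semifield_axioms
        F.valuation_value_map F.value_map_surj) simp_all
qed

theorem theorem3p4:
  fixes S :: "('a, 'x) ring_scheme"
  assumes "mc_semiring S"
  shows
    "(valuation_semiring S \<longleftrightarrow>
       (\<forall>x \<in> carrier (fract_semifield S). x \<noteq> \<zero>\<^bsub>fract_semifield S\<^esub> \<longrightarrow>
          x \<in> fract_embed S ` carrier S \<or> inv\<^bsub>fract_semifield S\<^esub> x \<in> fract_embed S ` carrier S)) \<and>
     ((\<forall>x \<in> carrier (fract_semifield S). x \<noteq> \<zero>\<^bsub>fract_semifield S\<^esub> \<longrightarrow>
          x \<in> fract_embed S ` carrier S \<or> inv\<^bsub>fract_semifield S\<^esub> x \<in> fract_embed S ` carrier S) \<longleftrightarrow>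
       (\<forall>I J. semiring_ideal I S \<and> semiring_ideal J S \<longrightarrow> I \<subseteq> J \<or> J \<subseteq> I)) \<and>
     ((\<forall>I J. semiring_ideal I S \<and> semiring_ideal J S \<longrightarrow> I \<subseteq> J \<or> J \<subseteq> I) \<longleftrightarrow>
       (\<forall>x \<in> carrier S. \<forall>y \<in> carrier S. PIdl\<^bsub>S\<^esub> x \<subseteq> PIdl\<^bsub>S\<^esub> y \<or> PIdl\<^bsub>S\<^esub> y \<subseteq> PIdl\<^bsub>S\<^esub> x)) \<and>
     (valuation_semiring_in TYPE('k) TYPE('m) S \<longrightarrow> valuation_semiring S)"
proof -
  interpret mc_semiring S by fact
  let ?chain = "\<forall>x \<in> carrier S. \<forall>y \<in> carrier S. PIdl\<^bsub>S\<^esub> x \<subseteq> PIdl\<^bsub>S\<^esub> y \<or> PIdl\<^bsub>S\<^esub> y \<subseteq> PIdl\<^bsub>S\<^esub> x"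
  have "?chain" if "valuation_semiring_in TYPE('k) TYPE('m) S"
    by (intro ballI valuation_semiring_in_cgenideals_chain[OF that])
  moreover have "?chain" if "valuation_semiring S"
    by (intro ballI valuation_semiring_in_cgenideals_chain[OF that[unfolded valuation_semiring_def]])
  moreover have "valuation_semiring S" if "?chain"
    using that
    by (intro valuation_semiring_if_fract_or_inv) (simp only: fract_or_inv_iff_cgenideals_chain)
  ultimately show ?thesis
    unfolding fract_or_inv_iff_cgenideals_chain ideals_chain_iff_cgenideals_chain by argo
qed

end
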